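(* Let $g_{\mathrm{GS}}:\mathbb{R}^6\to\mathrm{SO}(3)$ be the Gram-Schmidt orthogonalization mapping $(\mathbf{t}_1',\mathbf{t}_2')\mapsto(\mathbf{r}_1',\mathbf{r}_2',\mathbf{r}_3')$, where $\mathbf{t}_1',\mathbf{t}_2'\in\mathbb{R}^3$ and $$\mathbf{r}_1'=\frac{\mathbf{t}_1'}{\lVert\mathbf{t}_1'\rVert},\qquad \mathbf{r}_2''=\mathbf{t}_2'-(\mathbf{r}_1'\cdot\mathbf{t}_2')\mathbf{r}_1',\qquad \mathbf{r}_2'=\frac{\mathbf{r}_2''}{\lVert\mathbf{r}_2''\rVert},\qquad \mathbf{r}_3'=\mathbf{r}_1'\times\mathbf{r}_2'.$$ Let $J_{\mathrm{GS}}=\frac{\partial\,\mathrm{vec}(R)}{\partial\,\mathrm{vec}(\mathbf{t}_1',\mathbf{t}_2')}\in\mathbb{R}^{9\times 6}$, where $R$ is the matrix with columns $\mathbf{r}_1',\mathbf{r}_2',\mathbf{r}_3'$. Then: (1) Column 1 is self-contained: $\frac{\partial\mathbf{r}_1'}{\partial\mathbf{t}_1'}$ depends only on $\mathbf{t}_1'$, not on $\mathbf{t}_2'$. Its singular values are $\{1/\lVert\mathbf{t}_1'\rVert,\,1/\lVert\mathbf{t}_1'\rVert,\,0\}$ (rank $2$ due to radial degeneracy). (2) Column 2 depends on column 1: $\frac{\partial\mathbf{r}_2'}{\partial\mathbf{t}_1'}$ is generically nonzero while $\frac{\partial\mathbf{r}_1'}{\partial\mathbf{t}_2'}=0$. This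 creates a one-directional coupling: errors in $\mathbf{r}_2'$ affect updates to $\mathbf{t}_1'$, but errors in $\mathbf{r}_1'$ never affect updates to $\mathbf{t}_2'$. (3) Column 3 has no dedicated parameters: since $\mathbf{r}_3'=\mathbf{r}_1'\times\mathbf{r}_2'$, the gradient $\frac{\partial\mathbf{r}_3'}{\partial\mathbf{t}_k'}$ is entirely mediated through $\mathbf{r}_1'$ and $\mathbf{r}_2'$, compounding the distortion from two normalization layers. (4) The condition number diverges: as $\mathbf{t}_1'$ and $\mathbf{t}_2'$ become parallel (i.e., $\mathbf{r}_2''=\mathbf{t}_2'-(\mathbf{r}_1'\cdot\mathbf{t}_2')\mathbf{r}_1'\to 0$), the condition number of the Jacobian restricted to the column space satisfies $$\kappa(J_{\mathrm{GS}})\ge\frac{\lVert\mathbf{t}_1'\rVert}{\lVert\mathbf{r}_2''\rVert}.$$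
   Context: The vectors $\mathbf{t}_1',\mathbf{t}_2'$ are the six outputs of a network, trained by gradient descent on a loss that is a function of $R$; "updates to $\mathbf{t}_k'$" are the gradient updates obtained by backpropagation through $g_{\mathrm{GS}}$. The map is given by the displayed formulas wherever they are defined (nonzero denominators). $\mathrm{vec}$ denotes stacking into a vector. The condition number restricted to the column space is the ratio of the largest to the smallest nonzero singular value. *)

theory Defs
  imports "HOL-Analysis.Analysis"
begin

definition normalise :: "real^3 \<Rightarrow> real^3" where
  "normalise x = x /\<^sub>R norm x"

definition proj_out :: "real^3 \<Rightarrow> real^3 \<Rightarrow> real^3" where
  "proj_out u t = t - (u \<bullet> t) *\<^sub>R u"

definition gs_r1 :: "real^3 \<Rightarrow> real^3 \<Rightarrow> real^3" where
  "gs_r1 t1 t2 = normalise t1"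

(* The unnormalised second column. *)
definition gs_q2 :: "real^3 \<Rightarrow> real^3 \<Rightarrow> real^3" where
  "gs_q2 t1 t2 = proj_out (gs_r1 t1 t2) t2"

definition gs_r2 :: "real^3 \<Rightarrow> real^3 \<Rightarrow> real^3" where
  "gs_r2 t1 t2 = normalise (gs_q2 t1 t2)"

definition gs_r3 :: "real^3 \<Rightarrow> real^3 \<Rightarrow> real^3" where
  "gs_r3 t1 t2 = cross3 (gs_r1 t1 t2) (gs_r2 t1 t2)"

(* All denominators are nonzero. *)
definition gs_defined :: "real^3 \<Rightarrow> real^3 \<Rightarrow> bool" where
  "gs_defined t1 t2 \<longleftrightarrow> norm t1 \<noteq> 0 \<and> norm (gs_q2 t1 t2) \<noteq> 0"

(* The transpose turns the three listed vectors into columns. *)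
definition gs :: "real^3 \<Rightarrow> real^3 \<Rightarrow> real^3^3" where
  "gs t1 t2 = transpose (vector [gs_r1 t1 t2, gs_r2 t1 t2, gs_r3 t1 t2])"

(* Column-major stacking: R $ i $ j is row i, column j. *)
definition vec_mat :: "real^3^3 \<Rightarrow> real^9" where
  "vec_mat R = vector [R$1$1, R$2$1, R$3$1, R$1$2, R$2$2, R$3$2, R$1$3, R$2$3, R$3$3]"

definition vec_pair :: "real^3 \<Rightarrow> real^3 \<Rightarrow> real^6" where
  "vec_pair t1 t2 = vector [t1$1, t1$2, t1$3, t2$1, t2$2, t2$3]"

definition gs_vec :: "real^6 \<Rightarrow> real^9" where
  "gs_vec x = vec_mat (gs (vector [x$1, x$2, x$3]) (vector [x$4, x$5, x$6]))"

definition J_GS :: "real^3 \<Rightarrow> real^3 \<Rightarrow> real^6^9" where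
  "J_GS t1 t2 = jacobian gs_vec (at (vec_pair t1 t2))"

definition jac1 :: "(real^3 \<Rightarrow> real^3 \<Rightarrow> real^3) \<Rightarrow> real^3 \<Rightarrow> real^3 \<Rightarrow> real^3^3" where
  "jac1 f x y = jacobian (\<lambda>s. f s y) (at x)"

definition jac2 :: "(real^3 \<Rightarrow> real^3 \<Rightarrow> real^3) \<Rightarrow> real^3 \<Rightarrow> real^3 \<Rightarrow> real^3^3" where
  "jac2 f x y = jacobian (\<lambda>s. f x s) (at y)"

(* Square roots of the eigenvalues of the Gram matrix, counted with geometric
   (= algebraic, as the Gram matrix is symmetric) multiplicity.  An m x n matrix thus
   has n singular values; this agrees with the min(m,n) convention when n <= m. *)
definition singular_space :: "real^'n^'m \<Rightarrow> real \<Rightarrow> (real^'n) set" where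
  "singular_space A s = {v. (transpose A ** A) *v v = s\<^sup>2 *\<^sub>R v}"

definition singular_values :: "real^'n^'m \<Rightarrow> real multiset" where
  "singular_values A =
     (\<Sum>s\<in>{s. 0 \<le> s \<and> (\<exists>v\<in>singular_space A s. v \<noteq> 0)}. replicate_mset (dim (singular_space A s)) s)"

(* The index set of the sum above is finite, so the sum is not degenerate. *)
lemma finite_singular_values:
  fixes A :: "real^'n^'m"
  shows "finite {s. 0 \<le> s \<and> (\<exists>v\<in>singular_space A s. v \<noteq> 0)}" (is "finite ?S")
proof -
  define f where "f s = (SOME v. v \<in> singular_space A s \<and> v \<noteq> 0)" for s
  have f: "f s \<in> singular_space A s" "f s \<noteq> 0" if "s \<in> ?S" for s
    using that someI_ex[of "\<lambda>v. v \<in> singular_space A s \<and> v \<noteq> 0"] unfolding f_def by blast+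
  have orth: "f s \<bullet> f t = 0" if "s \<in> ?S" "t \<in> ?S" "s \<noteq> t" for s t
  proof -
    let ?G = "transpose A ** A"
    have sym: "transpose ?G = ?G" by (simp add: matrix_transpose_mul)
    have "s\<^sup>2 * (f s \<bullet> f t) = (?G *v f s) \<bullet> f t"
      using f(1)[OF that(1)] by (simp add: singular_space_def)
    also have "\<dots> = f s \<bullet> (?G *v f t)"
      by (metis dot_lmul_matrix sym transpose_matrix_vector)
    also have "\<dots> = t\<^sup>2 * (f s \<bullet> f t)"
      using f(1)[OF that(2)] by (simp add: singular_space_def)
    finally have "(s\<^sup>2 - t\<^sup>2) * (f s \<bullet> f t) = 0" by (simp add: algebra_simps)
    moreover have "s\<^sup>2 \<noteq> t\<^sup>2" using that by (auto simp: power2_eq_iff_nonneg)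
    ultimately show ?thesis by simp
  qed
  have inj: "inj_on f ?S"
    using orth f(2) by (metis (no_types, lifting) inj_onI inner_eq_zero_iff)
  have "pairwise orthogonal (f ` ?S)"
    unfolding pairwise_def orthogonal_def using orth by blast
  moreover have "0 \<notin> f ` ?S" using f(2) by (metis (no_types, lifting) imageE)
  ultimately have "independent (f ` ?S)" by (rule pairwise_orthogonal_independent)
  hence "finite (f ` ?S)" by (rule independent_imp_finite)
  thus ?thesis using inj by (rule finite_imageD)
qed

(* Condition number on the column space: only nonzero singular values enter. *)
definition cond_number :: "real^'n^'m \<Rightarrow> real" where
  "cond_number A =
     Max (set_mset (singular_values A) - {0}) / Min (set_mset (singular_values A) - {0})"

(* Holds on an open set of full measure; such a set is in particular dense. *)
definition generically :: "('a::euclidean_space \<Rightarrow> bool) \<Rightarrow> bool" where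
  "generically P \<longleftrightarrow> (\<exists>U. open U \<and> negligible (- U) \<and> (\<forall>x\<in>U. P x))"

definition grad :: "('a::real_inner \<Rightarrow> real) \<Rightarrow> 'a \<Rightarrow> 'a" where
  "grad f x = (THE d. GDERIV f x :> d)"

(* The error signal that a loss sends into column j of R = gs t1 t2: the gradient of the
   loss, as a function of a free 3 x 3 matrix, with respect to that column. *)
definition col_error :: "(real^3^3 \<Rightarrow> real) \<Rightarrow> real^3 \<Rightarrow> real^3 \<Rightarrow> 3 \<Rightarrow> real^3" where
  "col_error L t1 t2 j = column j (grad L (gs t1 t2))"

(* Gradient-descent updates with learning rate eta. *)
definition update1 :: "real \<Rightarrow> (real^3^3 \<Rightarrow> real) \<Rightarrow> real^3 \<Rightarrow> real^3 \<Rightarrow> real^3" where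
  "update1 \<eta> L t1 t2 = - \<eta> *\<^sub>R grad (\<lambda>s. L (gs s t2)) t1"

definition update2 :: "real \<Rightarrow> (real^3^3 \<Rightarrow> real) \<Rightarrow> real^3 \<Rightarrow> real^3 \<Rightarrow> real^3" where
  "update2 \<eta> L t1 t2 = - \<eta> *\<^sub>R grad (\<lambda>s. L (gs t1 s)) t2"

end

theory Submission imports Defs begin

text \<open>In the orthonormal frame \<open>r1, r2, r3\<close>, with \<open>t2 = b r1 + c r2\<close> and \<open>a = norm t1\<close>, the derivative of the
  Gram-Schmidt map in a direction \<open>(h, k)\<close> is
  \<open>dr1 = (h2 r2 + h3 r3) / a\<close>, \<open>dr2 = - (h2 / a) r1 + w r3\<close>, \<open>dr3 = - (h3 / a) r1 - w r2\<close>, where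
  \<open>w = (k3 - (b / a) h3) / c\<close>. Hence \<open>(r2, 0)\<close> is a right singular vector of the Jacobian with singular value
  \<open>sqrt 2 / a\<close>, while the unit vectors \<open>(0, r3)\<close> and \<open>(r3, 0)\<close> are stretched by \<open>sqrt 2 / c\<close> and
  \<open>sqrt 2 * norm t2 / (a c)\<close>. So the condition number is at least \<open>a / c\<close>, and also at least
  \<open>norm t2 / c\<close>; the latter gives the scale-free divergence. The points where the map is undefined lie in
  the images of \<open>t \<mapsto> (0, t)\<close> and \<open>(t, \<lambda>) \<mapsto> (t, \<lambda> t)\<close>, which have dimension at most 4.\<close>

subsection \<open>Coordinates in dimensions 6 and 9\<close>

lemma exhaust_6:
  fixes x :: 6
  shows "x = 1 \<or> x = 2 \<or> x = 3 \<or> x = 4 \<or> x = 5 \<or> x = 6"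
proof (induct x)
  case (of_int z)
  \<comment> \<open>Representatives run from 0 to 5, while the indices run from 1 to 6: the residue
    0 is the index \<open>6\<close>.\<close>
  hence "z = 0 \<or> z = 1 \<or> z = 2 \<or> z = 3 \<or> z = 4 \<or> z = 5" by fastforce
  then show ?case by auto
qed

lemma UNIV_6: "(UNIV::6 set) = {1, 2, 3, 4, 5, 6}"
  using exhaust_6 by auto

lemma forall_6: "(\<forall>i::6. P i) \<longleftrightarrow> P 1 \<and> P 2 \<and> P 3 \<and> P 4 \<and> P 5 \<and> P 6"
  by (metis exhaust_6)

lemma sum_6: "sum f (UNIV::6 set) = f 1 + f 2 + f 3 + f 4 + f 5 + f 6"
  unfolding UNIV_6 by (simp add: ac_simps)

lemma exhaust_9:
  fixes x :: 9
  shows "x = 1 \<or> x = 2 \<or> x = 3 \<or> x = 4 \<or> x = 5 \<or> x = 6 \<or> x = 7 \<or> x = 8 \<or> x = 9"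
proof (induct x)
  case (of_int z)
  hence "z = 0 \<or> z = 1 \<or> z = 2 \<or> z = 3 \<or> z = 4 \<or> z = 5 \<or> z = 6 \<or> z = 7 \<or> z = 8" by fastforce
  then show ?case by auto
qed

lemma UNIV_9: "(UNIV::9 set) = {1, 2, 3, 4, 5, 6, 7, 8, 9}"
  using exhaust_9 by auto

lemma forall_9: "(\<forall>i::9. P i) \<longleftrightarrow> P 1 \<and> P 2 \<and> P 3 \<and> P 4 \<and> P 5 \<and> P 6 \<and> P 7 \<and> P 8 \<and> P 9"
  by (metis exhaust_9)

lemma sum_9: "sum f (UNIV::9 set) = f 1 + f 2 + f 3 + f 4 + f 5 + f 6 + f 7 + f 8 + f 9"
  unfolding UNIV_9 by (simp add: ac_simps)

lemma vector_6 [simp]: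
  "(vector [a,b,c,d,e,f] :: ('a::zero)^6) $ 1 = a"
  "(vector [a,b,c,d,e,f] :: ('a::zero)^6) $ 2 = b"
  "(vector [a,b,c,d,e,f] :: ('a::zero)^6) $ 3 = c"
  "(vector [a,b,c,d,e,f] :: ('a::zero)^6) $ 4 = d"
  "(vector [a,b,c,d,e,f] :: ('a::zero)^6) $ 5 = e"
  "(vector [a,b,c,d,e,f] :: ('a::zero)^6) $ 6 = f"
  unfolding vector_def by simp_all

lemma vector_9 [simp]:
  "(vector [a,b,c,d,e,f,g,h,i] :: ('a::zero)^9) $ 1 = a"
  "(vector [a,b,c,d,e,f,g,h,i] :: ('a::zero)^9) $ 2 = b"
  "(vector [a,b,c,d,e,f,g,h,i] :: ('a::zero)^9) $ 3 = c"
  "(vector [a,b,c,d,e,f,g,h,i] :: ('a::zero)^9) $ 4 = d"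
  "(vector [a,b,c,d,e,f,g,h,i] :: ('a::zero)^9) $ 5 = e"
  "(vector [a,b,c,d,e,f,g,h,i] :: ('a::zero)^9) $ 6 = f"
  "(vector [a,b,c,d,e,f,g,h,i] :: ('a::zero)^9) $ 7 = g"
  "(vector [a,b,c,d,e,f,g,h,i] :: ('a::zero)^9) $ 8 = h"
  "(vector [a,b,c,d,e,f,g,h,i] :: ('a::zero)^9) $ 9 = i"
  unfolding vector_def by simp_all

text \<open>Uniqueness of the derivative lets every Jacobian matrix below be handled through its
  action on vectors.\<close>

lemma jacobian_mult:
  fixes f :: "real^'n \<Rightarrow> real^'m"
  assumes "(f has_derivative f') (at x)"
  shows "jacobian f (at x) *v h = f' h"
proof -
  have "(f has_derivative (\<lambda>h. jacobian f (at x) *v h)) (at x)"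
    using assms jacobian_works[of f "at x"] unfolding differentiable_def by auto
  from has_derivative_unique[OF this assms] show ?thesis by (rule fun_cong)
qed

subsection \<open>Singular values and gradients\<close>

lemma gram_inner:
  fixes A :: "real^'n^'m"
  shows "((transpose A ** A) *v v) \<bullet> w = (A *v v) \<bullet> (A *v w)"
  by (metis dot_lmul_matrix matrix_vector_mul_assoc transpose_matrix_vector)

text \<open>Weak form of the eigenvalue equation: only inner products of image vectors occur, so no
  transpose has to be computed.\<close>

lemma singular_space_iff:
  fixes A :: "real^'n^'m"
  shows "v \<in> singular_space A s \<longleftrightarrow> (\<forall>w. (A *v v) \<bullet> (A *v w) = s\<^sup>2 * (v \<bullet> w))"
proof -
  have "v \<in> singular_space A s \<longleftrightarrow> (\<forall>w. ((transpose A ** A) *v v) \<bullet> w = (s\<^sup>2 *\<^sub>R v) \<bullet> w)"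
    unfolding singular_space_def mem_Collect_eq by (metis vector_eq_rdot)
  thus ?thesis by (simp only: gram_inner inner_scaleR_left)
qed

text \<open>A nonzero vector makes the multiplicity positive, and finiteness of the index set keeps
  the sum from its default value 0.\<close>

lemma mem_singular_values:
  fixes A :: "real^'n^'m"
  shows "s \<in># singular_values A \<longleftrightarrow> 0 \<le> s \<and> (\<exists>v\<in>singular_space A s. v \<noteq> 0)"
proof -
  have "dim (singular_space A s) \<noteq> 0" if "v \<in> singular_space A s" "v \<noteq> 0" for s v
    using that by auto
  thus ?thesis
    unfolding singular_values_def set_mset_sum[OF finite_singular_values] by auto
qed

text \<open>The maximum of \<open>norm (A v)\<close> over the unit sphere is attained at a right singular vector.\<close>

lemma exists_singular_value_ge:
  fixes A :: "real^'n^'m"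
  assumes "v \<noteq> 0"
  shows "\<exists>s. s \<in># singular_values A \<and> norm (A *v v) / norm v \<le> s"
proof -
  have "v /\<^sub>R norm v \<in> sphere 0 1" using assms by simp
  hence "\<exists>u\<in>sphere 0 1. \<forall>w\<in>sphere 0 1. norm (A *v w) \<le> norm (A *v u)"
    by (intro continuous_attains_sup continuous_intros) auto
  then obtain u where u: "norm u = 1" and max: "\<And>w. norm w = 1 \<Longrightarrow> norm (A *v w) \<le> norm (A *v u)"
    unfolding Ball_def Bex_def mem_sphere_0 by metis
  define s where "s = norm (A *v u)"
  have le: "norm (A *v w) \<le> s * norm w" for w
  proof (cases "w = 0")
    case False
    hence "norm (A *v (w /\<^sub>R norm w)) \<le> s" unfolding s_def by (intro max) simp
    thus ?thesis using False by (simp add: matrix_vector_mult_scaleR field_simps)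
  qed simp
  \<comment> \<open>\<open>B\<close> is a positive semidefinite form that vanishes at the maximiser
    \<open>u\<close>; such a null vector must be \<open>B\<close>-orthogonal to everything.\<close>
  define B where "B x y = s\<^sup>2 * (x \<bullet> y) - (A *v x) \<bullet> (A *v y)" for x y
  have pos: "B w w \<ge> 0" for w
    using power_mono[OF le[of w], of 2]
    by (simp add: B_def power_mult_distrib power2_norm_eq_inner)
  have zero: "B u u = 0"
    using u by (simp add: B_def s_def power2_norm_eq_inner norm_eq_1)
  have "B u w = 0" for w
  proof -
    \<comment> \<open>Adding 1 keeps the denominator of the variation \<open>t\<close> positive even
      when \<open>B w w = 0\<close>.\<close>
    define g where "g = B w w + 1"
    have g: "B w w = g - 1" "g > 0" using pos[of w] by (simp_all add: g_def)
    define t where "t = - B u w / g"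
    have "B (u + t *\<^sub>R w) (u + t *\<^sub>R w) = B u u + 2 * t * B u w + t\<^sup>2 * B w w"
      by (simp add: B_def matrix_vector_right_distrib matrix_vector_mult_scaleR
          inner_add_left inner_add_right inner_commute power2_eq_square algebra_simps)
    also have "\<dots> = - ((B u w)\<^sup>2 * (g + 1) / g\<^sup>2)"
      using g(2) unfolding zero g(1) t_def by (simp add: field_simps power2_eq_square)
    finally have "(B u w)\<^sup>2 * (g + 1) / g\<^sup>2 \<le> 0"
      using pos[of "u + t *\<^sub>R w"] by linarith
    thus ?thesis using g(2)
      by (auto simp: divide_le_0_iff mult_le_0_iff)
  qed
  hence "u \<in> singular_space A s" by (simp add: singular_space_iff B_def)
  moreover have "u \<noteq> 0" "s \<ge> 0" using u by (auto simp: s_def)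
  moreover have "norm (A *v v) / norm v \<le> s"
    using le[of v] assms by (simp add: divide_le_eq)
  ultimately show ?thesis unfolding mem_singular_values by blast
qed

text \<open>The numerator is at least any stretch ratio and the denominator at most any positive
  singular value.\<close>

lemma cond_number_ge:
  fixes A :: "real^'n^'m"
  assumes "s \<in># singular_values A" "s > 0" "v \<noteq> 0"
  shows "norm (A *v v) / norm v / s \<le> cond_number A"
proof -
  let ?S = "set_mset (singular_values A) - {0}"
  obtain m where m: "m \<in># singular_values A" "norm (A *v v) / norm v \<le> m"
    using exists_singular_value_ge[OF \<open>v \<noteq> 0\<close>] by blast
  have s: "s \<in> ?S" using assms by auto
  have Mins: "Min ?S \<le> s" using s by simp
  have "Min ?S \<in> ?S" using s by (intro Min_in) auto
  hence Min_pos: "Min ?S > 0" by (auto simp: mem_singular_values less_le)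
  have "norm (A *v v) / norm v \<le> Max ?S"
  proof (cases "m = 0")
    \<comment> \<open>The value 0 is excluded from the set under \<open>Max\<close>; the ratio is
      then at most 0 and \<open>s\<close> serves as the bound instead.\<close>
    case True
    hence "norm (A *v v) / norm v \<le> s" using m assms by simp
    also have "s \<le> Max ?S" using s by simp
    finally show ?thesis .
  next
    case False
    hence "m \<le> Max ?S" using m by (intro Max_ge) auto
    thus ?thesis using m by simp
  qed
  thus ?thesis unfolding cond_number_def using Mins Min_pos
    by (intro frac_le) (auto intro: order_trans[of _ "norm (A *v v) / norm v"])
qed

section \<open>Gradients and their uniqueness\<close>

lemma grad_eqI: "GDERIV f x :> d \<Longrightarrow> grad f x = d"
  unfolding grad_def gderiv_def
proof (rule the_equality)
  fix e assume "(f has_derivative (\<lambda>h. h \<bullet> e)) (at x)" "(f has_derivative (\<lambda>h. h \<bullet> d)) (at x)"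
  hence "(\<lambda>h. h \<bullet> e) = (\<lambda>h. h \<bullet> d)" by (rule has_derivative_unique)
  thus "e = d" by (metis vector_eq_ldot)
qed

text \<open>Riesz representation: the gradient is the adjoint of the derivative applied to
  1.\<close>

lemma GDERIV_grad:
  fixes f :: "'a::euclidean_space \<Rightarrow> real"
  assumes "f differentiable (at x)"
  shows "GDERIV f x :> grad f x"
proof -
  obtain D where D: "(f has_derivative D) (at x)" using assms differentiable_def by blast
  have "D h = h \<bullet> adjoint D 1" for h
    using adjoint_works[OF has_derivative_linear[OF D], of h 1] by simp
  hence "D = (\<lambda>h. h \<bullet> adjoint D 1)" by (rule ext)
  hence G: "GDERIV f x :> adjoint D 1" using D by (simp add: gderiv_def)
  thus ?thesis using grad_eqI by metis
qed

text \<open>The predicate described in \<open>grad\<close> sees a function only through its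
  derivative, so both descriptions coincide.\<close>

lemma grad_cong:
  assumes "(f has_derivative D) (at x)" "(g has_derivative D) (at y)"
  shows "grad f x = grad g y"
proof -
  have "(GDERIV f x :> d) = (GDERIV g y :> d)" for d
    using assms has_derivative_unique unfolding gderiv_def by metis
  thus ?thesis by (simp add: grad_def)
qed

section \<open>Derivatives of normalisation and of the cross product\<close>

lemma has_derivative_linear_compose:
  fixes L :: "'a::euclidean_space \<Rightarrow> 'b::real_normed_vector"
  assumes "linear L" "(f has_derivative f') F"
  shows "((\<lambda>x. L (f x)) has_derivative (\<lambda>h. L (f' h))) F"
  using bounded_linear.has_derivative[OF _ assms(2)] assms(1) linear_conv_bounded_linear by blast

text \<open>The orthogonal projection along \<open>x\<close>, scaled by \<open>1 / norm x\<close>,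
  for nonzero \<open>x\<close>.\<close>

definition dnormalise :: "real^3 \<Rightarrow> real^3 \<Rightarrow> real^3" where
  "dnormalise x h = (h - (normalise x \<bullet> h) *\<^sub>R normalise x) /\<^sub>R norm x"

lemma has_derivative_normalise:
  assumes "x \<noteq> 0"
  shows "(normalise has_derivative dnormalise x) (at x)"
proof -
  have "(norm has_derivative (\<lambda>h. h \<bullet> sgn x)) (at x)"
    using assms by (rule has_derivative_norm)
  from has_derivative_scaleR[OF Deriv.has_derivative_inverse[OF _ this] has_derivative_ident] assms
  have "((\<lambda>x. x /\<^sub>R norm x) has_derivative
      (\<lambda>h. inverse (norm x) *\<^sub>R h + (- (inverse (norm x) * (h \<bullet> sgn x) * inverse (norm x))) *\<^sub>R x)) (at x)"
    by simp
  thus ?thesis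
    unfolding normalise_def[abs_def] dnormalise_def
    by (rule has_derivative_eq_rhs)
      (simp add: fun_eq_iff sgn_div_norm inner_commute algebra_simps)
qed

lemma has_derivative_cross3:
  assumes "(f has_derivative f') (at x)" "(g has_derivative g') (at x)"
  shows "((\<lambda>x. cross3 (f x) (g x)) has_derivative
          (\<lambda>h. cross3 (f' h) (g x) + cross3 (f x) (g' h))) (at x)"
  using bounded_bilinear.FDERIV[OF _ assms] bilinear_cross
  by (simp add: bilinear_conv_bounded_bilinear add.commute)

lemma normalise_inner_self: "x \<noteq> 0 \<Longrightarrow> normalise x \<bullet> normalise x = 1"
  by (simp add: normalise_def dot_square_norm power2_eq_square)

section \<open>Columns of a matrix and stacking into vectors\<close>

definition cols :: "real^3 \<Rightarrow> real^3 \<Rightarrow> real^3 \<Rightarrow> real^3^3" where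
  "cols x y z = transpose (vector [x, y, z])"

lemma gs_eq_cols: "gs t1 t2 = cols (gs_r1 t1 t2) (gs_r2 t1 t2) (gs_r3 t1 t2)"
  by (simp add: gs_def cols_def)

text \<open>The Frobenius inner product splits by columns; this is how a loss gradient separates
  into column errors.\<close>

lemma cols_inner: "cols x y z \<bullet> M = x \<bullet> column 1 M + y \<bullet> column 2 M + z \<bullet> column 3 M"
  by (simp add: cols_def transpose_def column_def inner_vec_def sum_3)

lemma column_cols:
  "column 1 (cols x y z) = x" "column 2 (cols x y z) = y" "column 3 (cols x y z) = z"
  by (simp_all add: cols_def column_transpose row_def vec_eq_iff)

lemma linear_cols: "linear (\<lambda>(x, y, z). cols x y z)"
  by (rule linearI) (auto simp: cols_def transpose_def vec_eq_iff forall_3)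

text \<open>Stacking is an isometry, so singular values can be computed from the matrix
  columns.\<close>

lemma vec_mat_inner: "vec_mat M \<bullet> vec_mat N = M \<bullet> N"
  by (simp add: vec_mat_def inner_vec_def sum_9 sum_3)

lemma linear_vec_mat: "linear vec_mat"
  by (rule linearI) (simp_all add: vec_mat_def vec_eq_iff forall_9)

text \<open>Inverse of \<open>vec_pair\<close>; it transfers derivatives from pairs of vectors to
  \<open>real^6\<close>.\<close>

definition unpair :: "real^6 \<Rightarrow> (real^3) \<times> (real^3)" where
  "unpair x = (vector [x$1, x$2, x$3], vector [x$4, x$5, x$6])"

lemma linear_unpair: "linear unpair"
  by (rule linearI) (simp_all add: unpair_def vec_eq_iff forall_3)

lemma unpair_vec_pair: "unpair (vec_pair x y) = (x, y)"
  by (simp add: unpair_def vec_pair_def vec_eq_iff forall_3)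

lemma vec_pair_unpair: "vec_pair (fst (unpair x)) (snd (unpair x)) = x"
  by (simp add: unpair_def vec_pair_def vec_eq_iff forall_6)

lemma vec_pair_inner: "vec_pair x y \<bullet> vec_pair u v = x \<bullet> u + y \<bullet> v"
  by (simp add: vec_pair_def inner_vec_def sum_6 sum_3)

lemma gs_vec_eq: "gs_vec x = vec_mat (gs (fst (unpair x)) (snd (unpair x)))"
  by (simp add: gs_vec_def unpair_def)

subsection \<open>The derivative of the Gram-Schmidt map\<close>

locale gram_schmidt =
  fixes t1 t2 :: "real^3"
  assumes defined: "gs_defined t1 t2"
begin

abbreviation "r1 \<equiv> gs_r1 t1 t2"
abbreviation "q2 \<equiv> gs_q2 t1 t2"
abbreviation "r2 \<equiv> gs_r2 t1 t2"
abbreviation "r3 \<equiv> gs_r3 t1 t2"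
abbreviation "Dr1 h \<equiv> dnormalise t1 h"

text \<open>This and the next three definitions are the derivatives at \<open>(t1, t2)\<close> in
  direction \<open>(h, k)\<close>, built up by the product and chain rules.\<close>

definition "Dq2 h k = k - (Dr1 h \<bullet> t2 + r1 \<bullet> k) *\<^sub>R r1 - (r1 \<bullet> t2) *\<^sub>R Dr1 h"
definition "Dr2 h k = dnormalise q2 (Dq2 h k)"
definition "Dr3 h k = cross3 (Dr1 h) r2 + cross3 r1 (Dr2 h k)"
definition "Dgs h k = cols (Dr1 h) (Dr2 h k) (Dr3 h k)"

lemma nonzero: "t1 \<noteq> 0" "q2 \<noteq> 0" "norm t1 > 0" "norm q2 > 0"
  using defined by (auto simp: gs_defined_def)

lemma r1_norm: "r1 \<bullet> r1 = 1"
  unfolding gs_r1_def using nonzero normalise_inner_self by blast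

lemma r2_norm: "r2 \<bullet> r2 = 1"
  unfolding gs_r2_def using nonzero normalise_inner_self by blast

lemma q2_eq: "q2 = norm q2 *\<^sub>R r2"
  using nonzero by (simp add: gs_r2_def normalise_def)

lemma r1_q2: "r1 \<bullet> q2 = 0"
  using r1_norm by (simp add: gs_q2_def proj_out_def inner_diff_right)

lemma r1_r2: "r1 \<bullet> r2 = 0"
  using r1_q2 by (simp add: gs_r2_def normalise_def)

lemma r3_orth: "r1 \<bullet> r3 = 0" "r2 \<bullet> r3 = 0"
  by (simp_all add: gs_r3_def dot_cross_self)

text \<open>Lagrange's identity for the norm of a cross product of orthogonal unit vectors.\<close>

lemma r3_norm: "r3 \<bullet> r3 = 1"
  using norm_cross_dot[of r1 r2] r1_r2 r1_norm r2_norm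
  by (simp add: gs_r3_def dot_square_norm power_mult_distrib)

lemmas frame = r1_norm r2_norm r3_norm r1_r2 r3_orth
  r1_r2[unfolded inner_commute[of r1]] r3_orth[unfolded inner_commute[of _ r3]]

text \<open>The QR decomposition of \<open>t2\<close>; it has no \<open>r3\<close>
  component.\<close>

lemma t2_eq: "t2 = (r1 \<bullet> t2) *\<^sub>R r1 + norm q2 *\<^sub>R r2"
  using q2_eq by (simp add: gs_q2_def proj_out_def)

lemma cross_r1_r3: "cross3 r1 r3 = - r2"
  using Lagrange[of r1 r1 r2] frame by (simp add: gs_r3_def)

lemma cross_r3_r2: "cross3 r3 r2 = - r1"
  using Lagrange[of r2 r1 r2] frame by (simp add: gs_r3_def cross_skew[of _ r2])

lemma orthogonal_gs: "orthogonal_matrix (gs t1 t2)"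
proof -
  have "transpose (gs t1 t2) ** gs t1 t2 = mat 1"
    using frame unfolding gs_eq_cols
    by (simp add: cols_def vec_eq_iff forall_3 matrix_matrix_mult_def mat_def inner_vec_def sum_3 transpose_def)
  thus ?thesis by (simp add: orthogonal_matrix)
qed

lemma det_gs: "det (gs t1 t2) = 1"
proof -
  \<comment> \<open>A cyclic shift of the rows preserves the determinant and turns it into a triple
    product.\<close>
  have "det (gs t1 t2) = det (vector [r3, r1, r2] :: real^3^3)"
    unfolding gs_def det_transpose by (simp add: det_3)
  also have "\<dots> = r3 \<bullet> cross3 r1 r2" by (simp add: dot_cross_det)
  finally show ?thesis using r3_norm by (simp add: gs_r3_def)
qed

lemma has_derivative_r1:
  "((\<lambda>p. gs_r1 (fst p) (snd p)) has_derivative (\<lambda>p. Dr1 (fst p))) (at (t1, t2))"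
proof -
  have "(fst has_derivative fst) (at (t1, t2))"
    by (rule has_derivative_fst[OF has_derivative_ident])
  from has_derivative_compose[OF this, of normalise "dnormalise t1"]
  show ?thesis unfolding gs_r1_def using has_derivative_normalise nonzero by simp
qed

lemma has_derivative_q2:
  "((\<lambda>p. gs_q2 (fst p) (snd p)) has_derivative (\<lambda>p. Dq2 (fst p) (snd p))) (at (t1, t2))"
  unfolding gs_q2_def proj_out_def Dq2_def
  by (rule derivative_eq_intros has_derivative_r1 refl)+ (simp add: fun_eq_iff algebra_simps)

lemma has_derivative_r2:
  "((\<lambda>p. gs_r2 (fst p) (snd p)) has_derivative (\<lambda>p. Dr2 (fst p) (snd p))) (at (t1, t2))"
  using has_derivative_compose[OF has_derivative_q2, of normalise "dnormalise q2"]
    has_derivative_normalise nonzero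
  by (simp add: gs_r2_def Dr2_def)

lemma has_derivative_r3:
  "((\<lambda>p. gs_r3 (fst p) (snd p)) has_derivative (\<lambda>p. Dr3 (fst p) (snd p))) (at (t1, t2))"
  using has_derivative_cross3[OF has_derivative_r1 has_derivative_r2]
  by (simp add: gs_r3_def Dr3_def)

lemma has_derivative_gs:
  "((\<lambda>p. gs (fst p) (snd p)) has_derivative (\<lambda>p. Dgs (fst p) (snd p))) (at (t1, t2))"
  using has_derivative_linear_compose[OF linear_cols has_derivative_Pair[OF has_derivative_r1
        has_derivative_Pair[OF has_derivative_r2 has_derivative_r3]]]
  by (simp add: gs_eq_cols Dgs_def)

lemma has_derivative_gs_vec:
  "(gs_vec has_derivative (\<lambda>x. vec_mat (Dgs (fst (unpair x)) (snd (unpair x))))) (at (vec_pair t1 t2))"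
proof -
  have "(unpair has_derivative unpair) (at (vec_pair t1 t2))"
    using has_derivative_linear_compose[OF linear_unpair has_derivative_ident] .
  from has_derivative_compose[OF this, of "\<lambda>p. gs (fst p) (snd p)"]
  have "((\<lambda>x. gs (fst (unpair x)) (snd (unpair x))) has_derivative
      (\<lambda>x. Dgs (fst (unpair x)) (snd (unpair x)))) (at (vec_pair t1 t2))"
    using has_derivative_gs by (simp add: unpair_vec_pair)
  from has_derivative_linear_compose[OF linear_vec_mat this]
  show ?thesis by (simp add: gs_vec_eq[abs_def])
qed

lemma has_derivative_partial:
  assumes "((\<lambda>p. f (fst p) (snd p)) has_derivative (\<lambda>p. F (fst p) (snd p))) (at (t1, t2))"
  shows "((\<lambda>s. f s t2) has_derivative (\<lambda>h. F h 0)) (at t1)"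
    and "((\<lambda>s. f t1 s) has_derivative F 0) (at t2)"
proof -
  have "((\<lambda>s. (s, t2)) has_derivative (\<lambda>h. (h, 0))) (at t1)"
    by (intro derivative_intros)
  from has_derivative_compose[OF this assms]
  show "((\<lambda>s. f s t2) has_derivative (\<lambda>h. F h 0)) (at t1)" by simp
  have "((\<lambda>s. (t1, s)) has_derivative (\<lambda>h. (0, h))) (at t2)"
    by (intro derivative_intros)
  from has_derivative_compose[OF this assms]
  show "((\<lambda>s. f t1 s) has_derivative F 0) (at t2)" by simp
qed

lemma J_GS_mult: "J_GS t1 t2 *v vec_pair h k = vec_mat (Dgs h k)"
  unfolding J_GS_def jacobian_mult[OF has_derivative_gs_vec] by (simp add: unpair_vec_pair)

text \<open>The Gram form of the Jacobian as a sum over columns, in the shape that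
  \<open>singular_space_iff\<close> asks for.\<close>

lemma J_GS_inner:
  "(J_GS t1 t2 *v vec_pair h k) \<bullet> (J_GS t1 t2 *v vec_pair h' k') =
    Dr1 h \<bullet> Dr1 h' + Dr2 h k \<bullet> Dr2 h' k' + Dr3 h k \<bullet> Dr3 h' k'"
  by (simp add: J_GS_mult vec_mat_inner Dgs_def cols_inner column_cols)

section \<open>The derivative in frame coordinates\<close>

lemma r2_Dr1: "r2 \<bullet> Dr1 h = (r2 \<bullet> h) / norm t1"
  using frame by (simp add: dnormalise_def gs_r1_def inner_diff_right divide_inverse)

lemma r1_Dr1: "r1 \<bullet> Dr1 h = 0"
  using frame by (simp add: dnormalise_def gs_r1_def inner_diff_right)

text \<open>In effect the derivative of \<open>r1 \<bullet> r2 = 0\<close>. Explicitly, the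
  \<open>r2\<close> part of \<open>t2\<close> contributes a factor \<open>norm q2\<close>, which the
  normalisation of \<open>q2\<close> cancels.\<close>

lemma r1_Dr2: "r1 \<bullet> Dr2 h k = - (r2 \<bullet> h) / norm t1"
proof -
  have "Dr1 h \<bullet> t2 = norm q2 * (r2 \<bullet> h) / norm t1"
    using r1_Dr1[of h] r2_Dr1[of h] arg_cong[OF t2_eq, of "\<lambda>x. Dr1 h \<bullet> x"]
    by (simp add: inner_add_right inner_commute)
  moreover have "r1 \<bullet> dnormalise q2 z = (r1 \<bullet> z) / norm q2" for z
    using frame unfolding dnormalise_def gs_r2_def[symmetric]
    by (simp add: inner_diff_right divide_inverse)
  moreover have "r1 \<bullet> Dq2 h k = - (Dr1 h \<bullet> t2)"
    using frame r1_Dr1[of h] by (simp add: Dq2_def inner_diff_right)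
  ultimately show ?thesis
    using nonzero by (simp add: Dr2_def)
qed

lemma Dr1_r2: "Dr1 r2 = r2 /\<^sub>R norm t1"
  using frame by (simp add: dnormalise_def gs_r1_def)

lemma Dr1_r3: "Dr1 r3 = r3 /\<^sub>R norm t1"
  using frame by (simp add: dnormalise_def gs_r1_def)

lemma Dr1_0: "Dr1 0 = 0"
  by (simp add: dnormalise_def)

lemma r2_t2: "r2 \<bullet> t2 = norm q2" and r3_t2: "r3 \<bullet> t2 = 0"
  using arg_cong[OF t2_eq, of "\<lambda>x. r2 \<bullet> x"] arg_cong[OF t2_eq, of "\<lambda>x. r3 \<bullet> x"] frame
  by (simp_all add: inner_add_right)

lemma Dr2_r2: "Dr2 r2 0 = - (r1 /\<^sub>R norm t1)"
  using frame nonzero r2_t2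
  by (simp add: Dr2_def Dq2_def Dr1_r2 dnormalise_def[of q2] gs_r2_def[symmetric]
      inner_diff_right algebra_simps divide_inverse)

text \<open>Moving \<open>t1\<close> along \<open>r2\<close> turns \<open>r1\<close> and
  \<open>r2\<close> within their own plane, so \<open>r3\<close> is stationary to first
  order.\<close>

lemma Dr3_r2: "Dr3 r2 0 = 0"
  by (simp add: Dr3_def Dr1_r2 Dr2_r2 cross_mult_left cross_mult_right)

lemma Dr2_0_r3: "Dr2 0 r3 = r3 /\<^sub>R norm q2"
  using frame
  by (simp add: Dr2_def Dq2_def Dr1_0 dnormalise_def[of q2] gs_r2_def[symmetric])

text \<open>Tilting \<open>r1\<close> towards \<open>r3\<close> makes the \<open>r1\<close> part of
  \<open>t2\<close> leave a residue along \<open>r3\<close>, which normalisation magnifies by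
  \<open>1 / norm q2\<close>.\<close>

lemma Dr2_r3_0: "Dr2 r3 0 = - ((r1 \<bullet> t2) / (norm t1 * norm q2)) *\<^sub>R r3"
  using frame r3_t2
  by (simp add: Dr2_def Dq2_def Dr1_r3 dnormalise_def[of q2] gs_r2_def[symmetric]
      inner_diff_right divide_inverse)

lemma Dr3_r3_0: "Dr3 r3 0 = - (r1 /\<^sub>R norm t1) + ((r1 \<bullet> t2) / (norm t1 * norm q2)) *\<^sub>R r2"
  by (simp add: Dr3_def Dr1_r3 Dr2_r3_0 cross_mult_left cross_mult_right cross_r1_r3 cross_r3_r2)

lemma Dr3_0_r3: "Dr3 0 r3 = - (r2 /\<^sub>R norm q2)"
  by (simp add: Dr3_def Dr1_0 Dr2_0_r3 cross_mult_left cross_mult_right cross_r1_r3)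

section \<open>Jacobian blocks and gradient updates\<close>

lemma jac_mult:
  assumes "((\<lambda>p. f (fst p) (snd p)) has_derivative (\<lambda>p. F (fst p) (snd p))) (at (t1, t2))"
  shows "jac1 f t1 t2 *v h = F h 0" "jac2 f t1 t2 *v k = F 0 k"
  unfolding jac1_def jac2_def
  using jacobian_mult[OF has_derivative_partial(1)[OF assms]]
    jacobian_mult[OF has_derivative_partial(2)[OF assms]] by simp_all

text \<open>The direction \<open>r2\<close> is sent to a nonzero multiple of
  \<open>r1\<close>.\<close>

lemma jac1_r2_nonzero: "jac1 gs_r2 t1 t2 \<noteq> 0"
proof
  assume "jac1 gs_r2 t1 t2 = 0"
  hence "Dr2 r2 0 = 0" using jac_mult(1)[OF has_derivative_r2, of r2] by simp
  hence "r1 \<bullet> r1 = 0" using nonzero by (simp add: Dr2_r2)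
  thus False using r1_norm by simp
qed

text \<open>The first two equations are the product rule. The last two resolve \<open>gs_r2\<close>
  into projection and normalisation, so that the normalisation layers appear as the factors
  \<open>N1\<close> and \<open>N2\<close>.\<close>

lemma jac_r3:
  defines "A \<equiv> jac1 cross3 r1 r2" and "B \<equiv> jac2 cross3 r1 r2"
    and "N1 \<equiv> jacobian normalise (at t1)" and "N2 \<equiv> jacobian normalise (at q2)"
  shows "jac1 gs_r3 t1 t2 = A ** jac1 gs_r1 t1 t2 + B ** jac1 gs_r2 t1 t2"
    and "jac2 gs_r3 t1 t2 = A ** jac2 gs_r1 t1 t2 + B ** jac2 gs_r2 t1 t2"
    and "jac1 gs_r3 t1 t2 = A ** N1 + B ** N2 ** jac1 proj_out r1 t2 ** N1"
    and "jac2 gs_r3 t1 t2 = B ** N2 ** jac2 proj_out r1 t2"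
proof -
  have A: "A *v h = cross3 h r2" for h
    unfolding A_def jac1_def
    using jacobian_mult[OF has_derivative_cross3[OF has_derivative_ident has_derivative_const]]
    by simp
  have B: "B *v k = cross3 r1 k" for k
    unfolding B_def jac2_def
    using jacobian_mult[OF has_derivative_cross3[OF has_derivative_const has_derivative_ident]]
    by simp
  have N: "N1 *v h = Dr1 h" "N2 *v h = dnormalise q2 h" for h
    unfolding N1_def N2_def using jacobian_mult[OF has_derivative_normalise] nonzero by blast+
  have "((\<lambda>s. proj_out s t2) has_derivative (\<lambda>h. - ((h \<bullet> t2) *\<^sub>R r1 + (r1 \<bullet> t2) *\<^sub>R h))) (at r1)"
    unfolding proj_out_def by (auto intro!: derivative_eq_intros simp: fun_eq_iff)
  hence P1: "jac1 proj_out r1 t2 *v h = - ((h \<bullet> t2) *\<^sub>R r1 + (r1 \<bullet> t2) *\<^sub>R h)" for h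
    unfolding jac1_def by (rule jacobian_mult)
  have "((\<lambda>s. proj_out r1 s) has_derivative (\<lambda>k. k - (r1 \<bullet> k) *\<^sub>R r1)) (at t2)"
    unfolding proj_out_def by (auto intro!: derivative_eq_intros simp: fun_eq_iff)
  hence P2: "jac2 proj_out r1 t2 *v k = k - (r1 \<bullet> k) *\<^sub>R r1" for k
    unfolding jac2_def by (rule jacobian_mult)
  note J = jac_mult[OF has_derivative_r1] jac_mult[OF has_derivative_r2] jac_mult[OF has_derivative_r3]
  \<comment> \<open>Matrix identities are checked on vectors, where matrix products become
    compositions of derivatives.\<close>
  note mv = matrix_eq matrix_vector_mult_add_rdistrib matrix_vector_mul_assoc[symmetric]
  show "jac1 gs_r3 t1 t2 = A ** jac1 gs_r1 t1 t2 + B ** jac1 gs_r2 t1 t2"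
    and "jac2 gs_r3 t1 t2 = A ** jac2 gs_r1 t1 t2 + B ** jac2 gs_r2 t1 t2"
    unfolding mv J A B Dr3_def by simp_all
  show "jac1 gs_r3 t1 t2 = A ** N1 + B ** N2 ** jac1 proj_out r1 t2 ** N1"
    unfolding mv J A B N P1 Dr3_def Dr2_def Dq2_def by (simp add: diff_diff_add)
  show "jac2 gs_r3 t1 t2 = B ** N2 ** jac2 proj_out r1 t2"
    unfolding mv J A B N P2 Dr3_def Dr2_def Dq2_def Dr1_0 by simp
qed

text \<open>The witness is the linear loss \<open>M \<mapsto> r1 \<bullet> column 2 M\<close>, whose pullback to \<open>t1\<close> has gradient
  \<open>- r2 / norm t1\<close>, against the zero loss.\<close>

lemma update1_sees_column2:
  assumes "\<eta> > 0"
  shows "\<exists>L L'. L differentiable (at (gs t1 t2)) \<and> L' differentiable (at (gs t1 t2)) \<and>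
           col_error L t1 t2 1 = col_error L' t1 t2 1 \<and>
           col_error L t1 t2 3 = col_error L' t1 t2 3 \<and>
           update1 \<eta> L t1 t2 \<noteq> update1 \<eta> L' t1 t2"
proof -
  define L where "L M = M \<bullet> cols 0 r1 0" for M
  define L' :: "real^3^3 \<Rightarrow> real" where "L' M = 0" for M
  have D: "(L has_derivative (\<lambda>h. h \<bullet> cols 0 r1 0)) (at M)" for M
    unfolding L_def by (auto intro!: derivative_eq_intros)
  hence grad: "grad L M = cols 0 r1 0" for M
    by (intro grad_eqI) (simp add: gderiv_def)
  have grad0: "grad (\<lambda>_. 0) x = 0" for x :: "'b::real_inner"
    by (rule grad_eqI) (rule GDERIV_const)
  have zero: "column j (0 :: real^3^3) = 0" for j
    by (simp add: column_def vec_eq_iff)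
  have "((\<lambda>s. L (gs s t2)) has_derivative (\<lambda>h. Dgs h 0 \<bullet> cols 0 r1 0)) (at t1)"
    using has_derivative_compose[OF has_derivative_partial(1)[OF has_derivative_gs] D] .
  moreover have "Dgs h 0 \<bullet> cols 0 r1 0 = h \<bullet> - (r2 /\<^sub>R norm t1)" for h
    using r1_Dr2[of h 0]
    by (simp add: Dgs_def cols_inner column_cols inner_commute divide_inverse)
  ultimately have "grad (\<lambda>s. L (gs s t2)) t1 = - (r2 /\<^sub>R norm t1)"
    by (intro grad_eqI) (simp add: gderiv_def)
  moreover have "r2 \<noteq> 0" using r2_norm by auto
  ultimately have "update1 \<eta> L t1 t2 \<noteq> update1 \<eta> L' t1 t2"
    using assms nonzero by (simp add: update1_def L'_def grad0)
  moreover have "col_error L t1 t2 j = col_error L' t1 t2 j" if "j = 1 \<or> j = 3" for j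
    using that
    by (auto simp: col_error_def grad column_cols L'_def[abs_def] grad0 zero)
  moreover have "L differentiable (at (gs t1 t2))" "L' differentiable (at (gs t1 t2))"
    using D unfolding differentiable_def L'_def by (blast intro: has_derivative_const)+
  ultimately show ?thesis by blast
qed

text \<open>A change of \<open>t2\<close> leaves \<open>r1\<close> fixed, so the error in column 1
  drops out of the chain rule.\<close>

lemma has_derivative_loss_t2:
  assumes "L differentiable (at (gs t1 t2))"
  shows "((\<lambda>s. L (gs t1 s)) has_derivative
    (\<lambda>k. Dr2 0 k \<bullet> col_error L t1 t2 2 + Dr3 0 k \<bullet> col_error L t1 t2 3)) (at t2)"
proof -
  have "(L has_derivative (\<lambda>h. h \<bullet> grad L (gs t1 t2))) (at (gs t1 t2))"
    using GDERIV_grad[OF assms] by (simp add: gderiv_def)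
  from has_derivative_compose[OF has_derivative_partial(2)[OF has_derivative_gs] this]
  show ?thesis by (simp add: Dgs_def cols_inner Dr1_0 col_error_def)
qed

lemma update2_cong:
  assumes "L differentiable (at (gs t1 t2))" "L' differentiable (at (gs t1 t2))"
    and "col_error L t1 t2 2 = col_error L' t1 t2 2" "col_error L t1 t2 3 = col_error L' t1 t2 3"
  shows "update2 \<eta> L t1 t2 = update2 \<eta> L' t1 t2"
  using grad_cong[OF has_derivative_loss_t2[OF assms(1)]] has_derivative_loss_t2[OF assms(2)] assms(3,4)
  by (simp add: update2_def)

section \<open>Lower bounds for the condition number\<close>

lemma singular_value_J_GS: "sqrt 2 / norm t1 \<in># singular_values (J_GS t1 t2)"
proof -
  \<comment> \<open>Columns 1 and 2 each contribute
    \<open>(r2 \<bullet> h) / (norm t1)\<^sup>2\<close> and column 3 nothing, whence the factor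
    2.\<close>
  have "(J_GS t1 t2 *v vec_pair r2 0) \<bullet> (J_GS t1 t2 *v vec_pair h k)
      = (sqrt 2 / norm t1)\<^sup>2 * (vec_pair r2 0 \<bullet> vec_pair h k)" for h k
    unfolding J_GS_inner Dr1_r2 Dr2_r2 Dr3_r2 vec_pair_inner
    by (simp add: r2_Dr1 r1_Dr2 power_divide divide_inverse power2_eq_square)
  hence "vec_pair r2 0 \<in> singular_space (J_GS t1 t2) (sqrt 2 / norm t1)"
    unfolding singular_space_iff by (metis vec_pair_unpair)
  moreover have "vec_pair r2 0 \<noteq> 0"
    using vec_pair_inner[of r2 0 r2 0] r2_norm by auto
  ultimately show ?thesis unfolding mem_singular_values by auto
qed

text \<open>A unit direction stretched by \<open>sqrt 2 * \<rho>\<close> is compared with the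
  singular value \<open>sqrt 2 / norm t1\<close>; the factors \<open>sqrt 2\<close> cancel.\<close>

lemma cond_number_J_GS_ge:
  assumes "h \<bullet> h + k \<bullet> k = 1" "\<rho> \<ge> 0"
    and "Dr1 h \<bullet> Dr1 h + Dr2 h k \<bullet> Dr2 h k + Dr3 h k \<bullet> Dr3 h k = 2 * \<rho>\<^sup>2"
  shows "\<rho> * norm t1 \<le> cond_number (J_GS t1 t2)"
proof -
  have 1: "norm (vec_pair h k) = 1"
    using assms by (simp add: norm_eq_1 vec_pair_inner)
  have "norm (J_GS t1 t2 *v vec_pair h k) = sqrt 2 * \<rho>"
    using assms unfolding norm_eq_sqrt_inner J_GS_inner by (simp add: real_sqrt_mult)
  moreover have "vec_pair h k \<noteq> 0" using 1 by auto
  ultimately show ?thesis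
    using cond_number_ge[OF singular_value_J_GS, of "vec_pair h k"] nonzero 1 by simp
qed

lemma cond_number_J_GS:
  shows "norm t1 / norm q2 \<le> cond_number (J_GS t1 t2)"
    and "norm t2 / norm q2 \<le> cond_number (J_GS t1 t2)"
proof -
  \<comment> \<open>The direction \<open>(0, r3)\<close> yields the first bound.\<close>
  have "Dr1 0 \<bullet> Dr1 0 + Dr2 0 r3 \<bullet> Dr2 0 r3 + Dr3 0 r3 \<bullet> Dr3 0 r3 = 2 * (1 / norm q2)\<^sup>2"
    using frame by (simp add: Dr1_0 Dr2_0_r3 Dr3_0_r3 power2_eq_square divide_inverse)
  from cond_number_J_GS_ge[OF _ _ this] frame
  show "norm t1 / norm q2 \<le> cond_number (J_GS t1 t2)" by simp
  \<comment> \<open>Pythagoras in the frame: it merges the two terms of the stretch in direction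
    \<open>(r3, 0)\<close> into a single square.\<close>
  have "(norm t2)\<^sup>2 = t2 \<bullet> t2" by (rule power2_norm_eq_inner)
  also have "\<dots> = (r1 \<bullet> t2) * (r1 \<bullet> t2) + norm q2 * norm q2"
    using arg_cong[OF t2_eq, of "\<lambda>x. t2 \<bullet> x"] r2_t2
    by (simp add: inner_add_right inner_commute)
  finally have t2: "(norm t2)\<^sup>2 = (r1 \<bullet> t2)\<^sup>2 + (norm q2)\<^sup>2" by (simp add: power2_eq_square)
  have "Dr1 r3 \<bullet> Dr1 r3 + Dr2 r3 0 \<bullet> Dr2 r3 0 + Dr3 r3 0 \<bullet> Dr3 r3 0
      = 2 * (1 / (norm t1)\<^sup>2 + (r1 \<bullet> t2)\<^sup>2 / (norm t1 * norm q2)\<^sup>2)"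
    using frame
    by (simp add: Dr1_r3 Dr2_r3_0 Dr3_r3_0 power2_eq_square inner_add_left inner_add_right
        divide_inverse algebra_simps)
  also have "\<dots> = 2 * (norm t2 / (norm t1 * norm q2))\<^sup>2"
    using nonzero unfolding power_divide t2 by (simp add: field_simps power_mult_distrib)
  finally have "norm t2 / (norm t1 * norm q2) * norm t1 \<le> cond_number (J_GS t1 t2)"
    using frame by (intro cond_number_J_GS_ge[of r3 0]) auto
  thus "norm t2 / norm q2 \<le> cond_number (J_GS t1 t2)" using nonzero by simp
qed

end

subsection \<open>Genericity, normalisation and divergence\<close>

lemma generically_gs_definedI:
  assumes "\<And>t1 t2. gs_defined t1 t2 \<Longrightarrow> P (t1, t2)"
  shows "generically P"
proof -
  \<comment> \<open>The cross product is nonzero exactly where the map is defined, and it is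
    continuous everywhere, which makes openness immediate.\<close>
  let ?U = "{p. cross3 (fst p) (snd p) \<noteq> 0}"
  let ?line = "\<lambda>(t, c). (t, c *\<^sub>R t) :: (real^3) \<times> (real^3)"
  let ?zero = "\<lambda>t. (0, t) :: (real^3) \<times> (real^3)"
  have compl: "p \<in> ?zero ` UNIV \<union> ?line ` UNIV" if "\<not> gs_defined (fst p) (snd p)" for p
  proof (cases "fst p = 0")
    case True
    thus ?thesis by (cases p) auto
  next
    case False
    hence "gs_q2 (fst p) (snd p) = 0" using that by (simp add: gs_defined_def)
    hence "snd p = ((gs_r1 (fst p) (snd p) \<bullet> snd p) / norm (fst p)) *\<^sub>R fst p"
      by (simp add: gs_q2_def proj_out_def gs_r1_def normalise_def divide_inverse)
    hence "p = ?line (fst p, (gs_r1 (fst p) (snd p) \<bullet> snd p) / norm (fst p))"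
      by (cases p) simp
    thus ?thesis by blast
  qed
  hence gs: "gs_defined (fst p) (snd p)" if "p \<in> ?U" for p
    using that by (force simp: cross_mult_right)
  have "cross3 t1 t2 \<noteq> 0" if "gs_defined t1 t2" for t1 t2
  proof -
    interpret gram_schmidt t1 t2 by unfold_locales fact
    have "t1 = norm t1 *\<^sub>R r1" using nonzero by (simp add: gs_r1_def normalise_def)
    moreover have "cross3 r1 t2 = norm q2 *\<^sub>R r3"
      using arg_cong[OF t2_eq, of "cross3 r1"]
      by (simp add: cross_add_right cross_mult_right gs_r3_def)
    ultimately have "cross3 t1 t2 = (norm t1 * norm q2) *\<^sub>R r3"
      by (metis cross_mult_left scaleR_scaleR)
    thus ?thesis using nonzero r3_norm by auto
  qed
  hence "- ?U \<subseteq> ?zero ` UNIV \<union> ?line ` UNIV" using compl by blast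
  moreover have "negligible (?zero ` UNIV)"
    by (rule negligible_differentiable_image_lowdim)
      (auto intro!: derivative_intros simp: differentiable_on_def)
  moreover have "(?line has_derivative (\<lambda>h. (fst h, snd p *\<^sub>R fst h + snd h *\<^sub>R fst p))) (at p)" for p
    unfolding split_def by (auto intro!: derivative_eq_intros)
  hence "negligible (?line ` UNIV)"
    by (intro negligible_differentiable_image_lowdim)
      (auto simp: differentiable_on_def intro: differentiableI)
  ultimately have "negligible (- ?U)" using negligible_Un negligible_subset by blast
  moreover have "open ?U"
    by (intro open_Collect_neq continuous_on_cross continuous_intros)
  moreover have "\<forall>p\<in>?U. P p" using gs assms by fastforce
  ultimately show ?thesis unfolding generically_def by blast
qed

section \<open>Singular values of the normalisation Jacobian\<close>

context
  fixes x :: "real^3"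
  assumes x: "x \<noteq> 0"
begin

lemma jacobian_normalise_mult: "jacobian normalise (at x) *v h = dnormalise x h"
  using jacobian_mult[OF has_derivative_normalise[OF x]] .

text \<open>The projection is symmetric and idempotent, so a single copy of it remains.\<close>

lemma dnormalise_inner:
  "dnormalise x v \<bullet> dnormalise x w = ((v - (normalise x \<bullet> v) *\<^sub>R normalise x) \<bullet> w) / (norm x)\<^sup>2"
  using normalise_inner_self[OF x]
  by (simp add: dnormalise_def inner_diff_left inner_diff_right inner_commute
      power2_eq_square divide_inverse algebra_simps)

text \<open>Singular vectors become eigenvectors of the projection along \<open>x\<close>, with
  eigenvalue \<open>(s * norm x)\<^sup>2\<close>.\<close>

lemma singular_space_normalise:
  "v \<in> singular_space (jacobian normalise (at x)) s \<longleftrightarrow>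
    v - (normalise x \<bullet> v) *\<^sub>R normalise x = (s * norm x)\<^sup>2 *\<^sub>R v"
proof -
  have "v \<in> singular_space (jacobian normalise (at x)) s \<longleftrightarrow>
      (\<forall>w. (v - (normalise x \<bullet> v) *\<^sub>R normalise x) \<bullet> w = ((s * norm x)\<^sup>2 *\<^sub>R v) \<bullet> w)"
    unfolding singular_space_iff jacobian_normalise_mult dnormalise_inner
    using x by (simp add: divide_eq_eq power_mult_distrib mult_ac)
  thus ?thesis by (metis vector_eq_rdot)
qed

lemma parallel_iff: "v = (normalise x \<bullet> v) *\<^sub>R normalise x \<longleftrightarrow> v \<in> span {x}"
proof
  assume "v = (normalise x \<bullet> v) *\<^sub>R normalise x"
  also have "\<dots> \<in> span {x}" by (simp add: normalise_def span_base span_scale)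
  finally show "v \<in> span {x}" .
next
  assume "v \<in> span {x}"
  then obtain c where "v = c *\<^sub>R x" unfolding span_singleton by blast
  thus "v = (normalise x \<bullet> v) *\<^sub>R normalise x"
    using x by (simp add: normalise_def dot_square_norm power2_eq_square)
qed

lemma kernel_jacobian_normalise: "{v. jacobian normalise (at x) *v v = 0} = span {x}"
proof -
  have "jacobian normalise (at x) *v v = 0 \<longleftrightarrow> v - (normalise x \<bullet> v) *\<^sub>R normalise x = 0" for v
    unfolding jacobian_normalise_mult dnormalise_def using x by simp
  thus ?thesis unfolding right_minus_eq parallel_iff by simp
qed

lemma singular_space_normalise_0: "singular_space (jacobian normalise (at x)) 0 = span {x}"
proof -
  have "v \<in> singular_space (jacobian normalise (at x)) 0 \<longleftrightarrow> v - (normalise x \<bullet> v) *\<^sub>R normalise x = 0" for v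
    unfolding singular_space_normalise by simp
  thus ?thesis unfolding right_minus_eq parallel_iff by blast
qed

lemma normalise_inner_eq_0: "normalise x \<bullet> v = 0 \<longleftrightarrow> x \<bullet> v = 0"
  using x by (simp add: normalise_def)

text \<open>Taking the inner product with \<open>normalise x\<close> annihilates the projected side
  of the eigenvalue equation.\<close>

lemma singular_space_normalise_orth:
  assumes "s \<noteq> 0" "v \<in> singular_space (jacobian normalise (at x)) s"
  shows "x \<bullet> v = 0"
proof -
  have "normalise x \<bullet> (v - (normalise x \<bullet> v) *\<^sub>R normalise x) = normalise x \<bullet> ((s * norm x)\<^sup>2 *\<^sub>R v)"
    using assms by (simp add: singular_space_normalise)
  hence "(s * norm x)\<^sup>2 * (normalise x \<bullet> v) = 0"
    using normalise_inner_self[OF x] by (simp add: inner_diff_right)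
  thus ?thesis using assms x by (simp add: normalise_inner_eq_0)
qed

lemma singular_space_normalise_1:
  "singular_space (jacobian normalise (at x)) (1 / norm x) = {v. x \<bullet> v = 0}"
  using singular_space_normalise_orth[of "1 / norm x"] x
  by (auto simp: singular_space_normalise normalise_inner_eq_0)

text \<open>The projection has eigenvalue 0 on the line through \<open>x\<close> and 1 on the plane
  orthogonal to it; the dimensions 1 and 2 are the multiplicities.\<close>

lemma singular_values_normalise:
  "singular_values (jacobian normalise (at x)) = {#1 / norm x, 1 / norm x, 0#}"
proof -
  have dim0: "dim (span {x}) = 1" using x by (simp add: dim_singleton)
  have dim1: "dim {v. x \<bullet> v = 0} = 2" using dim_hyperplane[OF x] by simp
  have pos: "s = 1 / norm x" if "s > 0" "v \<in> singular_space (jacobian normalise (at x)) s" "v \<noteq> 0" for s v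
  proof -
    have "v = (s * norm x)\<^sup>2 *\<^sub>R v"
      using normalise_inner_eq_0[THEN iffD2, OF singular_space_normalise_orth[OF _ that(2)]] that(1,2)
      by (simp add: singular_space_normalise)
    hence "(s * norm x)\<^sup>2 = 1" using that(3) by (metis scaleR_cancel_right scaleR_one)
    moreover have "s * norm x \<ge> 0" using that(1) by simp
    ultimately have "s * norm x = 1" by (simp add: power2_eq_1_iff)
    thus ?thesis using x by (simp add: field_simps)
  qed
  have ex: "\<exists>v\<in>singular_space (jacobian normalise (at x)) s. v \<noteq> 0" if "s = 0 \<or> s = 1 / norm x" for s
  proof -
    have "\<not> span {x} \<subseteq> {0}" "\<not> {v. x \<bullet> v = 0} \<subseteq> {0}"
      unfolding dim_eq_0[symmetric] using dim0 dim1 by simp_all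
    thus ?thesis using that singular_space_normalise_0 singular_space_normalise_1 by blast
  qed
  have "{s. 0 \<le> s \<and> (\<exists>v\<in>singular_space (jacobian normalise (at x)) s. v \<noteq> 0)} = {0, 1 / norm x}"
    (is "?S = _")
  proof (intro equalityI subsetI)
    fix s assume "s \<in> ?S"
    thus "s \<in> {0, 1 / norm x}" using pos by (cases "s = 0") (auto simp: less_le)
  next
    fix s assume "s \<in> {0, 1 / norm x}"
    thus "s \<in> ?S" using ex by auto
  qed
  hence "singular_values (jacobian normalise (at x))
      = replicate_mset (dim (span {x})) 0 + replicate_mset (dim {v. x \<bullet> v = 0}) (1 / norm x)"
    unfolding singular_values_def using x
    by (simp add: singular_space_normalise_0 singular_space_normalise_1[simplified])
  thus ?thesis unfolding dim0 dim1 by (simp add: numeral_2_eq_2)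
qed

lemma rank_jacobian_normalise: "rank (jacobian normalise (at x)) = 2"
proof -
  have "range (\<lambda>v. jacobian normalise (at x) *v v) = {v. x \<bullet> v = 0}"
  proof (intro equalityI subsetI)
    fix v assume "v \<in> range (\<lambda>v. jacobian normalise (at x) *v v)"
    thus "v \<in> {v. x \<bullet> v = 0}"
      using normalise_inner_self[OF x]
      unfolding normalise_inner_eq_0[symmetric]
      by (auto simp: jacobian_normalise_mult dnormalise_def inner_diff_right)
  next
    fix v assume "v \<in> {v. x \<bullet> v = 0}"
    hence "normalise x \<bullet> v = 0" by (simp add: normalise_inner_eq_0)
    \<comment> \<open>On the plane orthogonal to \<open>x\<close> the derivative is division by
      \<open>norm x\<close>, which dictates the preimage.\<close>
    hence "v = jacobian normalise (at x) *v (norm x *\<^sub>R v)"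
      using x by (simp add: jacobian_normalise_mult dnormalise_def)
    thus "v \<in> range (\<lambda>v. jacobian normalise (at x) *v v)" by blast
  qed
  thus ?thesis using dim_hyperplane[OF x] by (simp add: rank_dim_range)
qed

end

text \<open>The filter says that \<open>g\<close> tends to 0 through positive values within
  \<open>S\<close>, without fixing a limit point. There \<open>C / g x\<close> diverges and bounds
  \<open>f\<close> from below.\<close>

lemma filterlim_at_top_inverse_bound:
  fixes f g :: "'a \<Rightarrow> real"
  assumes "C > 0" "\<And>x. x \<in> S \<Longrightarrow> g x > 0 \<Longrightarrow> C / g x \<le> f x"
  shows "filterlim f at_top (inf (filtercomap g (at_right 0)) (principal S))"
proof (rule filterlim_at_top_mono)
  have "filterlim (\<lambda>r. C * inverse r) at_top (at_right (0::real))"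
    using filterlim_tendsto_pos_mult_at_top[OF tendsto_const assms(1) filterlim_inverse_at_top_right] .
  from filterlim_compose[OF this filterlim_filtercomap[of g]]
  show "filterlim (\<lambda>x. C / g x) at_top (inf (filtercomap g (at_right 0)) (principal S))"
    unfolding divide_inverse by (rule filterlim_mono) simp_all
  have "eventually (\<lambda>x. g x > 0) (filtercomap g (at_right 0))"
    by (rule eventually_filtercomapI) (simp add: eventually_at_right_less)
  thus "eventually (\<lambda>x. C / g x \<le> f x) (inf (filtercomap g (at_right 0)) (principal S))"
    unfolding eventually_inf_principal by eventually_elim (use assms(2) in blast)
qed

theorem theorem2:
  shows
    \<comment> \<open>the map takes values in SO(3) and is differentiable wherever it is defined\<close>
    "(\<forall>t1 t2. gs_defined t1 t2 \<longrightarrow>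
        orthogonal_matrix (gs t1 t2) \<and> det (gs t1 t2) = 1 \<and>
        gs_vec differentiable (at (vec_pair t1 t2))) \<and>
     \<comment> \<open>(1)\<close>
     (\<forall>t1 t2. t1 \<noteq> 0 \<longrightarrow>
        (\<lambda>s. gs_r1 s t2) differentiable (at t1) \<and>
        (\<forall>t2'. jac1 gs_r1 t1 t2 = jac1 gs_r1 t1 t2') \<and>
        singular_values (jac1 gs_r1 t1 t2) = {#1 / norm t1, 1 / norm t1, 0#} \<and>
        rank (jac1 gs_r1 t1 t2) = 2 \<and>
        {v. jac1 gs_r1 t1 t2 *v v = 0} = span {t1}) \<and>
     \<comment> \<open>(2)\<close>
     generically (\<lambda>(t1, t2). gs_defined t1 t2 \<and> jac1 gs_r2 t1 t2 \<noteq> 0) \<and>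
     (\<forall>t1 t2. t1 \<noteq> 0 \<longrightarrow> jac2 gs_r1 t1 t2 = 0) \<and>
     generically (\<lambda>(t1, t2). gs_defined t1 t2 \<and>
        (\<forall>\<eta>>0. \<exists>L L'. L differentiable (at (gs t1 t2)) \<and> L' differentiable (at (gs t1 t2)) \<and>
           col_error L t1 t2 1 = col_error L' t1 t2 1 \<and>
           col_error L t1 t2 3 = col_error L' t1 t2 3 \<and>
           update1 \<eta> L t1 t2 \<noteq> update1 \<eta> L' t1 t2)) \<and>
     (\<forall>t1 t2 \<eta> L L'. gs_defined t1 t2 \<and> \<eta> > 0 \<and>
        L differentiable (at (gs t1 t2)) \<and> L' differentiable (at (gs t1 t2)) \<and>
        col_error L t1 t2 2 = col_error L' t1 t2 2 \<and>
        col_error L t1 t2 3 = col_error L' t1 t2 3 \<longrightarrow>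
          update2 \<eta> L t1 t2 = update2 \<eta> L' t1 t2) \<and>
     \<comment> \<open>(3)\<close>
     (\<forall>t1 t2. gs_defined t1 t2 \<longrightarrow>
        (let r1 = gs_r1 t1 t2; r2 = gs_r2 t1 t2; q2 = gs_q2 t1 t2;
             A = jac1 cross3 r1 r2; B = jac2 cross3 r1 r2;
             N1 = jacobian normalise (at t1); N2 = jacobian normalise (at q2) in
         jac1 gs_r3 t1 t2 = A ** jac1 gs_r1 t1 t2 + B ** jac1 gs_r2 t1 t2 \<and>
         jac2 gs_r3 t1 t2 = A ** jac2 gs_r1 t1 t2 + B ** jac2 gs_r2 t1 t2 \<and>
         jac1 gs_r3 t1 t2 = A ** N1 + B ** N2 ** jac1 proj_out r1 t2 ** N1 \<and>
         jac2 gs_r3 t1 t2 = B ** N2 ** jac2 proj_out r1 t2)) \<and>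
     \<comment> \<open>(4)\<close>
     (\<forall>t1 t2. gs_defined t1 t2 \<longrightarrow>
        cond_number (J_GS t1 t2) \<ge> norm t1 / norm (gs_q2 t1 t2)) \<and>
     (\<forall>\<delta>>0. filterlim (\<lambda>(t1, t2). cond_number (J_GS t1 t2)) at_top
        (inf (filtercomap (\<lambda>(t1, t2). norm (gs_q2 t1 t2)) (at_right 0))
             (principal {(t1, t2). norm t1 \<ge> \<delta>}))) \<and>
     filterlim (\<lambda>(t1, t2). cond_number (J_GS t1 t2)) at_top
        (inf (filtercomap (\<lambda>(t1, t2). norm (gs_q2 t1 t2) / norm t2) (at_right 0))
             (principal {(t1, t2). t1 \<noteq> 0}))"
proof (intro conjI)
  show "\<forall>t1 t2. gs_defined t1 t2 \<longrightarrow>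
      orthogonal_matrix (gs t1 t2) \<and> det (gs t1 t2) = 1 \<and>
      gs_vec differentiable (at (vec_pair t1 t2))"
    using gram_schmidt.orthogonal_gs gram_schmidt.det_gs
      differentiableI[OF gram_schmidt.has_derivative_gs_vec]
    unfolding gram_schmidt_def by blast
  show "\<forall>t1 t2. t1 \<noteq> 0 \<longrightarrow>
      (\<lambda>s. gs_r1 s t2) differentiable (at t1) \<and>
      (\<forall>t2'. jac1 gs_r1 t1 t2 = jac1 gs_r1 t1 t2') \<and>
      singular_values (jac1 gs_r1 t1 t2) = {#1 / norm t1, 1 / norm t1, 0#} \<and>
      rank (jac1 gs_r1 t1 t2) = 2 \<and>
      {v. jac1 gs_r1 t1 t2 *v v = 0} = span {t1}"
    by (simp add: jac1_def gs_r1_def differentiableI[OF has_derivative_normalise]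
        singular_values_normalise rank_jacobian_normalise kernel_jacobian_normalise)
  show "generically (\<lambda>(t1, t2). gs_defined t1 t2 \<and> jac1 gs_r2 t1 t2 \<noteq> 0)"
    by (rule generically_gs_definedI) (simp add: gram_schmidt.jac1_r2_nonzero gram_schmidt_def)
  show "\<forall>t1 t2. t1 \<noteq> 0 \<longrightarrow> jac2 gs_r1 t1 t2 = 0"
    unfolding jac2_def gs_r1_def by (simp add: matrix_eq jacobian_mult[OF has_derivative_const])
  show "generically (\<lambda>(t1, t2). gs_defined t1 t2 \<and>
      (\<forall>\<eta>>0. \<exists>L L'. L differentiable (at (gs t1 t2)) \<and> L' differentiable (at (gs t1 t2)) \<and>
         col_error L t1 t2 1 = col_error L' t1 t2 1 \<and>
         col_error L t1 t2 3 = col_error L' t1 t2 3 \<and>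
         update1 \<eta> L t1 t2 \<noteq> update1 \<eta> L' t1 t2))"
    using gram_schmidt.update1_sees_column2
    by (intro generically_gs_definedI) (simp add: gram_schmidt_def)
  show "\<forall>t1 t2 \<eta> L L'. gs_defined t1 t2 \<and> \<eta> > 0 \<and>
      L differentiable (at (gs t1 t2)) \<and> L' differentiable (at (gs t1 t2)) \<and>
      col_error L t1 t2 2 = col_error L' t1 t2 2 \<and>
      col_error L t1 t2 3 = col_error L' t1 t2 3 \<longrightarrow>
        update2 \<eta> L t1 t2 = update2 \<eta> L' t1 t2"
    by (metis gram_schmidt.update2_cong gram_schmidt_def)
  show "\<forall>t1 t2. gs_defined t1 t2 \<longrightarrow>
      (let r1 = gs_r1 t1 t2; r2 = gs_r2 t1 t2; q2 = gs_q2 t1 t2;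
           A = jac1 cross3 r1 r2; B = jac2 cross3 r1 r2;
           N1 = jacobian normalise (at t1); N2 = jacobian normalise (at q2) in
       jac1 gs_r3 t1 t2 = A ** jac1 gs_r1 t1 t2 + B ** jac1 gs_r2 t1 t2 \<and>
       jac2 gs_r3 t1 t2 = A ** jac2 gs_r1 t1 t2 + B ** jac2 gs_r2 t1 t2 \<and>
       jac1 gs_r3 t1 t2 = A ** N1 + B ** N2 ** jac1 proj_out r1 t2 ** N1 \<and>
       jac2 gs_r3 t1 t2 = B ** N2 ** jac2 proj_out r1 t2)"
    unfolding Let_def by (intro allI impI conjI; rule gram_schmidt.jac_r3; simp add: gram_schmidt_def)
  show "\<forall>t1 t2. gs_defined t1 t2 \<longrightarrow>
      cond_number (J_GS t1 t2) \<ge> norm t1 / norm (gs_q2 t1 t2)"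
    using gram_schmidt.cond_number_J_GS(1) unfolding gram_schmidt_def by blast
  show "\<forall>\<delta>>0. filterlim (\<lambda>(t1, t2). cond_number (J_GS t1 t2)) at_top
      (inf (filtercomap (\<lambda>(t1, t2). norm (gs_q2 t1 t2)) (at_right 0))
           (principal {(t1, t2). norm t1 \<ge> \<delta>}))"
  proof (intro allI impI filterlim_at_top_inverse_bound)
    fix \<delta> :: real and p :: "(real^3) \<times> (real^3)"
    assume \<delta>: "\<delta> > 0" and p: "p \<in> {(t1, t2). norm t1 \<ge> \<delta>}" "(\<lambda>(t1, t2). norm (gs_q2 t1 t2)) p > 0"
    obtain t1 t2 where [simp]: "p = (t1, t2)" by fastforce
    have "gram_schmidt t1 t2" using \<delta> p by (auto simp: gram_schmidt_def gs_defined_def)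
    hence "norm t1 / norm (gs_q2 t1 t2) \<le> cond_number (J_GS t1 t2)"
      by (rule gram_schmidt.cond_number_J_GS(1))
    \<comment> \<open>The lower bound on \<open>norm t1\<close> gives a constant numerator, uniform
      over the filter.\<close>
    moreover have "\<delta> / norm (gs_q2 t1 t2) \<le> norm t1 / norm (gs_q2 t1 t2)"
      using p by (intro divide_right_mono) auto
    ultimately show "\<delta> / (\<lambda>(t1, t2). norm (gs_q2 t1 t2)) p \<le> (\<lambda>(t1, t2). cond_number (J_GS t1 t2)) p"
      by simp
  qed
  show "filterlim (\<lambda>(t1, t2). cond_number (J_GS t1 t2)) at_top
      (inf (filtercomap (\<lambda>(t1, t2). norm (gs_q2 t1 t2) / norm t2) (at_right 0))
           (principal {(t1, t2). t1 \<noteq> 0}))"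
  proof (rule filterlim_at_top_inverse_bound[OF zero_less_one])
    fix p :: "(real^3) \<times> (real^3)"
    assume p: "p \<in> {(t1, t2). t1 \<noteq> 0}" "(\<lambda>(t1, t2). norm (gs_q2 t1 t2) / norm t2) p > 0"
    obtain t1 t2 where [simp]: "p = (t1, t2)" by fastforce
    \<comment> \<open>A positive quotient forces \<open>gs_q2 t1 t2\<close> to be nonzero, so the
      point lies in the domain.\<close>
    have "gram_schmidt t1 t2" using p by (auto simp: gram_schmidt_def gs_defined_def)
    from gram_schmidt.cond_number_J_GS(2)[OF this]
    show "1 / (\<lambda>(t1, t2). norm (gs_q2 t1 t2) / norm t2) p \<le> (\<lambda>(t1, t2). cond_number (J_GS t1 t2)) p"
      by simp
  qed
qed

end
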